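(* Let $(\mathbf{x}_k)$ be the stationary linear Gaussian process described in the context, let $\mathbf{c}\in\mathbb{R}^N\setminus\{0\}$, $\Delta\in\mathbb{R}$, $s_k=\mathbf{c}^\top\mathbf{x}_k$, $\bar s=\mathbf{c}^\top\bar{\mathbf{x}}$, $\sigma_s^2=\mathbf{c}^\top\boldsymbol{\Sigma}\mathbf{c}$ with $\sigma_s>0$, and $a=(\Delta-\bar s)/\sigma_s$. Then the pair $(s_k,s_{k+1})$ is jointly Gaussian with correlation coefficient $$\rho_s=\frac{\mathbf{c}^\top\mathbf{A}\boldsymbol{\Sigma}\mathbf{c}}{\mathbf{c}^\top\boldsymbol{\Sigma}\mathbf{c}},$$ and the one-step switching probabilities between the binary states $0:=\{s_k<\Delta\}$ and $1:=\{s_k\ge\Delta\}$ are $$q_{01}:=\mathbb{P}(s_{k+1}\ge\Delta\mid s_k<\Delta)=1-\frac{\Phi_2(a,a;\rho_s)}{\Phi(a)},$$ $$q_{10}:=\mathbb{P}(s_{k+1}<\Delta\mid s_k\ge\Delta)=\frac{\Phi(a)-\Phi_2(a,a;\rho_s)}{1-\Phi(a)}.$$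
   Context: The state process is $\mathbf{x}_{k+1}=\mathbf{A}\mathbf{x}_k+\mathbf{w}_k$ with $\mathbf{A}\in\mathbb{R}^{N\times N}$, where the $\mathbf{w}_k\sim\mathcal{N}(\boldsymbol{\mu}_w,\mathbf{Q})$ are independent over $k$ and $\mathbf{w}_k$ is independent of $\mathbf{x}_k$. It is assumed that $(\mathbf{A},\mathbf{Q}^{1/2})$ is controllable and that the spectral radius of $\mathbf{A}$ is less than $1$. The process is in its stationary regime: $\mathbf{x}_k\sim\mathcal{N}(\bar{\mathbf{x}},\boldsymbol{\Sigma})$ for every $k$, where $\bar{\mathbf{x}}=(\mathbf{I}-\mathbf{A})^{-1}\boldsymbol{\mu}_w$ and $\boldsymbol{\Sigma}$ is the solution of the discrete-time Lyapunov equation $\boldsymbol{\Sigma}=\mathbf{A}\boldsymbol{\Sigma}\mathbf{A}^\top+\mathbf{Q}$. $\Phi$ is the standard normal CDF, and $\Phi_2(\cdot,\cdot;\rho)$ is the joint CDF of two standard normal variables that are jointly Gaussian with correlation $\rho$. *)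

theory Defs
  imports "HOL-Probability.Probability"
begin

definition psd :: "real^'n^'n \<Rightarrow> bool" where
  "psd S \<longleftrightarrow> transpose S = S \<and> (\<forall>u. 0 \<le> u \<bullet> (S *v u))"

definition spectral_radius :: "real^'n^'n \<Rightarrow> real" where
  "spectral_radius A = Max (cmod ` {l. \<exists>v::complex^'n. v \<noteq> 0 \<and>
     (\<chi> i j. complex_of_real (A $ i $ j)) *v v = l *s v})"

text \<open>The Kalman rank condition: the set below consists of the columns of the block matrix
  \<open>[B, A B, \<dots>, A\<^sup>n\<^sup>-\<^sup>1 B]\<close>, which has to have full row rank \<open>n\<close>. The iterate of \<open>X \<mapsto> A X\<close> is used
  since \<open>^\<close> is not the matrix power on this type.\<close>

definition controllable :: "real^'n^'n \<Rightarrow> real^'m^'n \<Rightarrow> bool" where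
  "controllable A B \<longleftrightarrow>
     dim (\<Union>i<CARD('n). columns (((\<lambda>X. A ** X) ^^ i) B)) = CARD('n)"

text \<open>The normal law with mean \<open>m\<close> and variance \<open>v \<ge> 0\<close>; variance 0 is the point mass.\<close>

definition normal_law :: "real \<Rightarrow> real \<Rightarrow> real measure" where
  "normal_law m v =
     (if v = 0 then return borel m else density lborel (normal_density m (sqrt v)))"

text \<open>\<open>X \<sim> N(\<mu>, S)\<close>, with \<open>S\<close> possibly singular: every linear functional of \<open>X\<close> is normal with
  the induced mean and variance.\<close>

definition multivariate_normal ::
    "'w measure \<Rightarrow> ('w \<Rightarrow> real^'n) \<Rightarrow> real^'n \<Rightarrow> real^'n^'n \<Rightarrow> bool" where
  "multivariate_normal M X \<mu> S \<longleftrightarrow>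
     X \<in> borel_measurable M \<and> psd S \<and>
     (\<forall>u. distr M borel (\<lambda>\<omega>. u \<bullet> X \<omega>) = normal_law (u \<bullet> \<mu>) (u \<bullet> (S *v u)))"

definition jointly_gaussian :: "'w measure \<Rightarrow> ('w \<Rightarrow> real) \<Rightarrow> ('w \<Rightarrow> real) \<Rightarrow> bool" where
  "jointly_gaussian M X Y \<longleftrightarrow>
     (\<exists>\<mu> S. multivariate_normal M (\<lambda>\<omega>. vector [X \<omega>, Y \<omega>] :: real^2) \<mu> S)"

definition covariance :: "'w measure \<Rightarrow> ('w \<Rightarrow> real) \<Rightarrow> ('w \<Rightarrow> real) \<Rightarrow> real" where
  "covariance M X Y =
     (LINT \<omega>|M. (X \<omega> - (LINT \<omega>|M. X \<omega>)) * (Y \<omega> - (LINT \<omega>|M. Y \<omega>)))"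

definition correlation :: "'w measure \<Rightarrow> ('w \<Rightarrow> real) \<Rightarrow> ('w \<Rightarrow> real) \<Rightarrow> real" where
  "correlation M X Y = covariance M X Y / sqrt (covariance M X X * covariance M Y Y)"

definition Phi :: "real \<Rightarrow> real" where
  "Phi = cdf std_normal_distribution"

text \<open>For \<open>\<bar>\<rho>\<bar> \<le> 1\<close>, the joint law of two standard normal variables that are jointly Gaussian with
  correlation \<open>\<rho>\<close>, realised as the law of \<open>(Z, \<rho> Z + \<surd>(1 - \<rho>\<^sup>2) W)\<close> with \<open>Z, W\<close> independent standard
  normal. Unlike the density formula, this includes \<open>\<rho> = \<plusminus>1\<close>. The lemmas
  below show that the coordinates have the required properties, which determine the law.\<close>

definition std_bivariate_normal :: "real \<Rightarrow> (real \<times> real) measure" where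
  "std_bivariate_normal \<rho> =
     distr (std_normal_distribution \<Otimes>\<^sub>M std_normal_distribution) borel
       (\<lambda>(z, w). (z, \<rho> * z + sqrt (1 - \<rho>\<^sup>2) * w))"

definition Phi2 :: "real \<Rightarrow> real \<Rightarrow> real \<Rightarrow> real" where
  "Phi2 a b \<rho> = measure (std_bivariate_normal \<rho>) ({..a} \<times> {..b})"

lemma prob_space_std_normal: "prob_space std_normal_distribution"
  by (simp add: prob_space_normal_density)

lemma pair_prob_space_std_normal:
  "pair_prob_space std_normal_distribution std_normal_distribution"
  by (simp add: pair_prob_space_def pair_sigma_finite_def prob_space_std_normal
      prob_space_imp_sigma_finite)

lemma char_normal_law:
  assumes "0 \<le> v"
  shows "char (normal_law 0 v) t = exp (- (v * t\<^sup>2) / 2)"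
proof (cases "v = 0")
  case True
  then show ?thesis by (simp add: normal_law_def char_def integral_return)
next
  case False
  interpret prob_space std_normal_distribution by (rule prob_space_std_normal)
  have v: "0 < v" using False assms by simp
  have "distributed std_normal_distribution lborel (\<lambda>x. x) std_normal_density"
    by (auto simp: distributed_def distr_id2 sets_density)
  from normal_density_affine[OF this, of "sqrt v" 0] v
  have "distr std_normal_distribution lborel (\<lambda>x. sqrt v * x) = density lborel (normal_density 0 (sqrt v))"
    by (simp add: distributed_def)
  then have eq: "normal_law 0 v = distr std_normal_distribution borel (\<lambda>x. sqrt v * x)"
  proof -
    have "distr std_normal_distribution borel (\<lambda>x. sqrt v * x)
        = distr std_normal_distribution lborel (\<lambda>x. sqrt v * x)"
      by (rule distr_cong) simp_all
    with \<open>distr std_normal_distribution lborel _ = _\<close> show ?thesis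
      using False by (simp only: normal_law_def if_False)
  qed
  have "char (normal_law 0 v) t = char std_normal_distribution (sqrt v * t)"
    unfolding eq char_def by (subst integral_distr) (auto simp: mult_ac)
  also have "\<dots> = exp (- (v * t\<^sup>2) / 2)"
    using v unfolding char_std_normal_distribution by (simp add: power_mult_distrib)
  finally show ?thesis .
qed

lemma real_distribution_normal_law:
  assumes "0 \<le> v" shows "real_distribution (normal_law m v)"
  using assms unfolding real_distribution_def real_distribution_axioms_def normal_law_def
  by (auto intro!: prob_space_return prob_space_normal_density)

lemma distr_lincomb_std_normal:
  "distr (std_normal_distribution \<Otimes>\<^sub>M std_normal_distribution) borel (\<lambda>z. a * fst z + b * snd z)
     = normal_law 0 (a\<^sup>2 + b\<^sup>2)" (is "distr ?P borel ?f = _")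
proof (rule Levy_uniqueness)
  interpret pair_prob_space std_normal_distribution std_normal_distribution
    by (rule pair_prob_space_std_normal)
  have [measurable]: "?f \<in> borel_measurable ?P" by measurable
  show "real_distribution (distr ?P borel ?f)"
    unfolding real_distribution_def real_distribution_axioms_def
    by (auto intro!: prob_space_distr)
  show "real_distribution (normal_law 0 (a\<^sup>2 + b\<^sup>2))"
    by (rule real_distribution_normal_law) simp
  show "char (distr ?P borel ?f) = char (normal_law 0 (a\<^sup>2 + b\<^sup>2))"
  proof
    fix t
    have "char (distr ?P borel ?f) t = (CLINT z|?P. iexp ((t * a) * fst z) * iexp ((t * b) * snd z))"
      unfolding char_def
      by (subst integral_distr) (auto simp: exp_add[symmetric] algebra_simps)
    also have "\<dots> = (CLINT x|std_normal_distribution. CLINT y|std_normal_distribution.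
        iexp ((t * a) * x) * iexp ((t * b) * y))"
      by (subst integral_fst'[symmetric])
        (auto intro!: integrable_const_bound[where B=1] simp: norm_mult)
    also have "\<dots> = char std_normal_distribution (t * a) * char std_normal_distribution (t * b)"
      unfolding char_def by simp
    also have "\<dots> = exp (- ((a\<^sup>2 + b\<^sup>2) * t\<^sup>2) / 2)"
      by (simp add: char_std_normal_distribution exp_of_real[symmetric] exp_add[symmetric]
          power_mult_distrib field_simps)
    also have "\<dots> = char (normal_law 0 (a\<^sup>2 + b\<^sup>2)) t"
      by (simp add: char_normal_law)
    finally show "char (distr ?P borel ?f) t = char (normal_law 0 (a\<^sup>2 + b\<^sup>2)) t" .
  qed
qed

lemma normal_law_std: "normal_law 0 1 = std_normal_distribution"
  by (simp add: normal_law_def)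

lemma distr_lincomb_std_bivariate_normal:
  assumes "\<bar>\<rho>\<bar> \<le> 1"
  shows "distr (std_bivariate_normal \<rho>) borel (\<lambda>z. u * fst z + v * snd z)
    = normal_law 0 (u\<^sup>2 + v\<^sup>2 + 2 * \<rho> * u * v)"
proof -
  have r: "\<rho>\<^sup>2 \<le> 1" using assms by (simp add: abs_square_le_1)
  have "distr (std_bivariate_normal \<rho>) borel (\<lambda>z. u * fst z + v * snd z)
    = distr (std_normal_distribution \<Otimes>\<^sub>M std_normal_distribution) borel
       (\<lambda>z. (u + v * \<rho>) * fst z + (v * sqrt (1 - \<rho>\<^sup>2)) * snd z)"
    unfolding std_bivariate_normal_def
    by (subst distr_distr) (auto simp: borel_prod[symmetric] comp_def algebra_simps split_beta' intro!: distr_cong)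
  also have "\<dots> = normal_law 0 ((u + v * \<rho>)\<^sup>2 + (v * sqrt (1 - \<rho>\<^sup>2))\<^sup>2)"
    by (rule distr_lincomb_std_normal)
  also have "(u + v * \<rho>)\<^sup>2 + (v * sqrt (1 - \<rho>\<^sup>2))\<^sup>2 = u\<^sup>2 + v\<^sup>2 + 2 * \<rho> * u * v"
    using r by (simp add: power_mult_distrib power2_eq_square algebra_simps)
  finally show ?thesis .
qed

lemma std_bivariate_normal_marginals:
  assumes "\<bar>\<rho>\<bar> \<le> 1"
  shows "distr (std_bivariate_normal \<rho>) borel fst = std_normal_distribution"
    and "distr (std_bivariate_normal \<rho>) borel snd = std_normal_distribution"
  using distr_lincomb_std_bivariate_normal[OF assms, of 1 0]
    distr_lincomb_std_bivariate_normal[OF assms, of 0 1]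
  by (simp_all add: normal_law_std)

lemma sets_std_bivariate_normal [simp, measurable_cong]:
  "sets (std_bivariate_normal \<rho>) = sets (borel :: (real \<times> real) measure)"
  by (simp add: std_bivariate_normal_def)

lemma jointly_gaussian_std_bivariate_normal:
  assumes "\<bar>\<rho>\<bar> \<le> 1"
  shows "jointly_gaussian (std_bivariate_normal \<rho>) fst snd"
proof -
  define S :: "real^2^2" where "S = vector [vector [1, \<rho>], vector [\<rho>, 1]]"
  have S: "u \<bullet> (S *v u) = (u$1)\<^sup>2 + (u$2)\<^sup>2 + 2 * \<rho> * u$1 * u$2" for u
    by (simp add: S_def inner_vec_def matrix_vector_mult_def sum_2 power2_eq_square algebra_simps)
  have r: "\<rho>\<^sup>2 \<le> 1" using assms by (simp add: abs_square_le_1)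
  have "0 \<le> u \<bullet> (S *v u)" for u
  proof -
    have "u \<bullet> (S *v u) = (u$1 + \<rho> * u$2)\<^sup>2 + (1 - \<rho>\<^sup>2) * (u$2)\<^sup>2"
      unfolding S by (simp add: power2_eq_square algebra_simps)
    then show ?thesis using r by simp
  qed
  moreover have "transpose S = S"
    by (simp add: S_def transpose_def vec_eq_iff forall_2)
  ultimately have "psd S" by (simp add: psd_def)
  moreover have "(\<lambda>z. vector [fst z, snd z] :: real^2) \<in> borel_measurable (std_bivariate_normal \<rho>)"
  proof (subst borel_measurable_euclidean_space, intro ballI)
    fix i :: "real^2" assume "i \<in> Basis"
    have "(\<lambda>z. (vector [fst z, snd z] :: real^2) \<bullet> i) = (\<lambda>z. fst z * i$1 + snd z * i$2)"
      by (simp add: inner_vec_def sum_2)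
    then show "(\<lambda>z. (vector [fst z, snd z] :: real^2) \<bullet> i) \<in> borel_measurable (std_bivariate_normal \<rho>)"
      by (simp add: borel_prod[symmetric] measurable_cong_sets[OF sets_std_bivariate_normal refl])
  qed
  moreover have "distr (std_bivariate_normal \<rho>) borel (\<lambda>z. u \<bullet> (vector [fst z, snd z] :: real^2))
      = normal_law (u \<bullet> 0) (u \<bullet> (S *v u))" for u
    using distr_lincomb_std_bivariate_normal[OF assms, of "u$1" "u$2"]
    unfolding S by (simp add: inner_vec_def sum_2)
  ultimately show ?thesis
    unfolding jointly_gaussian_def multivariate_normal_def by blast
qed

lemma correlation_std_bivariate_normal:
  assumes "\<bar>\<rho>\<bar> \<le> 1"
  shows "correlation (std_bivariate_normal \<rho>) fst snd = \<rho>"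
proof -
  let ?N = std_normal_distribution and ?B = "std_bivariate_normal \<rho>"
  interpret pair_prob_space ?N ?N by (rule pair_prob_space_std_normal)
  have mfs: "fst \<in> borel_measurable ?B" "snd \<in> borel_measurable ?B"
    by (simp_all add: borel_prod[symmetric] measurable_cong_sets[OF sets_std_bivariate_normal refl])
  have m: "LINT x|?N. x = 0" "LINT x|?N. x\<^sup>2 = 1" "integrable ?N (\<lambda>x. x)" "integrable ?N (\<lambda>x. x\<^sup>2)"
    using integral_std_normal_distribution_moment_odd[of 1] std_normal_distribution_even_moments[of 1]
      integrable_std_normal_distribution_moment[of 1] by (simp_all add: fact_numeral)
  have tr: "LINT z|?B. g (fst z) = LINT x|?N. g x" "LINT z|?B. g (snd z) = LINT x|?N. g x"
    if "g \<in> borel_measurable borel" for g :: "real \<Rightarrow> real"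
    using integral_distr[OF mfs(1) that] integral_distr[OF mfs(2) that]
    by (simp_all add: std_bivariate_normal_marginals[OF assms])
  have e: "LINT z|?B. fst z = 0" "LINT z|?B. snd z = 0"
      "LINT z|?B. (fst z)\<^sup>2 = 1" "LINT z|?B. (snd z)\<^sup>2 = 1"
  proof -
    have b: "(\<lambda>x. x) \<in> borel_measurable borel" "(\<lambda>x::real. x\<^sup>2) \<in> borel_measurable borel"
      by simp_all
    show "LINT z|?B. fst z = 0" by (rule trans[OF tr(1)[OF b(1)] m(1)])
    show "LINT z|?B. snd z = 0" by (rule trans[OF tr(2)[OF b(1)] m(1)])
    show "LINT z|?B. (fst z)\<^sup>2 = 1" by (rule trans[OF tr(1)[OF b(2)] m(2)])
    show "LINT z|?B. (snd z)\<^sup>2 = 1" by (rule trans[OF tr(2)[OF b(2)] m(2)])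
  qed
  have "LINT z|?B. fst z * snd z
      = (LINT z|(?N \<Otimes>\<^sub>M ?N). \<rho> * (fst z)\<^sup>2 + sqrt (1 - \<rho>\<^sup>2) * (fst z * snd z))"
    unfolding std_bivariate_normal_def
    by (subst integral_distr)
      (auto simp: borel_prod[symmetric] split_beta' power2_eq_square algebra_simps)
  also have "\<dots> = \<rho>"
  proof -
    have d: "distr (?N \<Otimes>\<^sub>M ?N) ?N fst = ?N" "distr (?N \<Otimes>\<^sub>M ?N) ?N snd = ?N"
      using distr_lincomb_std_normal[of 1 0] distr_lincomb_std_normal[of 0 1]
      by (simp_all add: normal_law_std cong: distr_cong)
    have mN: "fst \<in> measurable (?N \<Otimes>\<^sub>M ?N) ?N" "snd \<in> measurable (?N \<Otimes>\<^sub>M ?N) ?N"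
      by simp_all
    have sq: "(\<lambda>x. x\<^sup>2) \<in> borel_measurable ?N" by simp
    have i1: "integrable (?N \<Otimes>\<^sub>M ?N) (\<lambda>z. (fst z)\<^sup>2)" "integrable (?N \<Otimes>\<^sub>M ?N) (\<lambda>z. (snd z)\<^sup>2)"
      using integrable_distr_eq[OF mN(1) sq] integrable_distr_eq[OF mN(2) sq] m by (simp_all add: d)
    have E1: "LINT z|(?N \<Otimes>\<^sub>M ?N). (fst z)\<^sup>2 = 1"
      using integral_distr[OF mN(1) sq] m by (simp add: d)
    have i2: "integrable (?N \<Otimes>\<^sub>M ?N) (\<lambda>z. fst z * snd z)"
    proof (rule Bochner_Integration.integrable_bound[OF Bochner_Integration.integrable_add[OF i1]])
      have "\<bar>p * q\<bar> \<le> p\<^sup>2 + q\<^sup>2" for p q :: real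
      proof -
        have "2 * \<bar>p\<bar> * \<bar>q\<bar> \<le> p\<^sup>2 + q\<^sup>2"
          using sum_squares_bound[of "\<bar>p\<bar>" "\<bar>q\<bar>"] by simp
        moreover have "0 \<le> \<bar>p\<bar> * \<bar>q\<bar>" by simp
        ultimately show ?thesis unfolding abs_mult by linarith
      qed
      then show "AE z in ?N \<Otimes>\<^sub>M ?N. norm (fst z * snd z) \<le> norm ((fst z)\<^sup>2 + (snd z)\<^sup>2 :: real)"
        by simp
    qed simp
    have E2: "LINT z|(?N \<Otimes>\<^sub>M ?N). fst z * snd z = 0"
      using integral_fst'[OF i2] m by simp
    show ?thesis using i1 i2 by (simp add: E1 E2)
  qed
  finally have c: "LINT z|?B. fst z * snd z = \<rho>" .
  show ?thesis
    unfolding correlation_def covariance_def by (simp add: e c power2_eq_square[symmetric])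
qed

end

theory Submission
  imports Defs
begin

text \<open>A linear functional of the pair \<open>(s\<^sub>k, s\<^sub>k\<^sub>+\<^sub>1)\<close> is the sum of a functional of \<open>x\<^sub>k\<close> and one of
  \<open>w\<^sub>k\<close>, hence a sum of two independent normal variables; the Lyapunov equation turns its variance
  into \<open>\<sigma>\<^sub>s\<^sup>2 (u\<^sup>2 + v\<^sup>2 + 2 \<rho>\<^sub>s u v)\<close>. By the Cramer-Wold principle the standardised pair has
  the bivariate normal law, from which correlation and quadrant probabilities are read off. The
  Cramer-Wold principle in the plane is reduced to Levy's uniqueness theorem on the line: weighting
  a law on the plane by \<open>1 + cos (v y)\<close> or \<open>1 + sin (v y)\<close> and projecting to the first coordinate
  gives finite measures whose characteristic functions are known.\<close>

section \<open>Finite measures on the line and their characteristic functions\<close>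

text \<open>Levy's theorem is about probability measures. The value at 0 of the characteristic
  function is the total mass, so both measures have the same mass, and dividing by it reduces the
  claim to \<open>Levy_uniqueness\<close>.\<close>

lemma finite_measure_eqI_char:
  fixes M N :: "real measure"
  assumes fin: "finite_measure M" "finite_measure N"
    and sets: "sets M = sets borel" "sets N = sets borel"
    and char: "char M = char N"
  shows "M = N"
proof -
  have char0: "char L 0 = measure L (space L)" for L
    by (simp add: char_def scaleR_conv_of_real)
  define m where "m = measure M (space M)"
  have m: "measure N (space N) = m"
    using char0[of M] char0[of N] unfolding char m_def by (metis of_real_eq_iff)
  have emM: "emeasure M (space M) = ennreal m" and emN: "emeasure N (space N) = ennreal m"
    using fin by (simp_all add: m m_def[symmetric] finite_measure.emeasure_eq_measure)
  show ?thesis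
  proof (cases "m = 0")
    \<comment> \<open>Normalising is impossible here, but both measures vanish.\<close>
    case True
    show ?thesis
    proof (rule measure_eqI)
      fix X assume "X \<in> sets M"
      then show "emeasure M X = emeasure N X"
        using emM emN True sets sets_eq_imp_space_eq[OF sets(1)] sets_eq_imp_space_eq[OF sets(2)]
          emeasure_space[of M X] emeasure_space[of N X] by simp
    qed (simp add: sets)
  next
    case False
    then have m_pos: "0 < m" by (simp add: m_def zero_less_measure_iff)
    \<comment> \<open>Normalisation to total mass 1, with the same factor for both measures, so that
      it can be undone at the end.\<close>
    define K where "K L = density L (\<lambda>_. ennreal (1 / m))" for L :: "real measure"
    have K_emeasure: "emeasure (K L) X = ennreal (1 / m) * emeasure L X" if "X \<in> sets L" for L X
      using that by (simp add: K_def emeasure_density nn_integral_cmult)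
    have K_distr: "real_distribution (K L)"
      if "sets L = sets borel" "emeasure L (space L) = ennreal m" for L
    proof -
      have "emeasure (K L) (space (K L)) = 1"
        using K_emeasure[OF sets.top, of L] that(2) m_pos
        by (simp add: K_def ennreal_mult'[symmetric])
      then show ?thesis
        using that sets_eq_imp_space_eq[OF that(1)]
        unfolding real_distribution_def real_distribution_axioms_def
        by (auto intro: prob_spaceI simp: K_def)
    qed
    have K_char: "char (K L) t = (1 / m) *\<^sub>R char L t" if "sets L = sets borel" for L t
      using that m_pos unfolding K_def char_def
      by (subst integral_density) (auto simp: measurable_cong_sets[OF that refl])
    have K_eq: "K M = K N"
      by (rule Levy_uniqueness) (use K_distr sets emM emN K_char char in auto)
    show ?thesis
    proof (rule measure_eqI)
      fix X assume X: "X \<in> sets M"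
      then have "ennreal m * emeasure (K M) X = ennreal m * emeasure (K N) X" by (simp add: K_eq)
      then show "emeasure M X = emeasure N X"
        using X m_pos by (simp add: K_emeasure sets mult.assoc[symmetric] ennreal_mult'[symmetric])
    qed (simp add: sets)
  qed
qed

section \<open>Weighted image measures and uniqueness in the plane\<close>

text \<open>Bridge between image measures and Bochner integrals: equality of weighted marginals can
  be read as equality of real integrals, where signed weights such as \<open>cos\<close> and
  \<open>sin\<close> make sense.\<close>

lemma emeasure_distr_density_real:
  assumes f: "integrable M f" "\<And>x. 0 \<le> f x" and g: "g \<in> borel_measurable M" and X: "X \<in> sets borel"
  shows "emeasure (distr (density M (\<lambda>x. ennreal (f x))) borel g) X
    = ennreal (LINT x|M. indicator X (g x) * f x)"
proof -
  have gX: "g -` X \<inter> space M \<in> sets M" using g X by measurable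
  have "emeasure (distr (density M (\<lambda>x. ennreal (f x))) borel g) X
      = (\<integral>\<^sup>+x. ennreal (f x) * indicator (g -` X \<inter> space M) x \<partial>M)"
    using assms gX by (subst emeasure_distr) (auto simp: emeasure_density)
  also have "\<dots> = (\<integral>\<^sup>+x. ennreal (indicator X (g x) * f x) \<partial>M)"
    by (rule nn_integral_cong) (auto simp: indicator_def)
  also have "\<dots> = ennreal (LINT x|M. indicator X (g x) * f x)"
  proof (rule nn_integral_eq_integral)
    have "(\<lambda>x. indicator X (g x) :: real) \<in> borel_measurable M" using g X by measurable
    with f(1) show "integrable M (\<lambda>x. indicator X (g x) * f x)"
      by (auto intro!: Bochner_Integration.integrable_bound[OF f(1)] simp: indicator_def)
  qed (use f in simp)
  finally show ?thesis .
qed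

lemma finite_measure_distr_density_real:
  assumes "integrable M f" "\<And>x. 0 \<le> f x" "g \<in> borel_measurable M"
  shows "finite_measure (distr (density M (\<lambda>x. ennreal (f x))) borel (g :: _ \<Rightarrow> real))"
  using emeasure_distr_density_real[OF assms, of UNIV] by (intro finite_measureI) simp

lemma char_distr_density_real:
  assumes f: "f \<in> borel_measurable M" "\<And>x. 0 \<le> f x" and g: "g \<in> borel_measurable M"
  shows "char (distr (density M (\<lambda>x. ennreal (f x))) borel g) t
    = (CLINT x|M. iexp (t * g x) * complex_of_real (f x))"
  using assms unfolding char_def
  by (subst integral_distr) (auto simp: integral_density scaleR_conv_of_real mult.commute)

text \<open>The weight \<open>1 + g\<close> is nonnegative, so the one-dimensional theorem applies to the law of the
  first coordinate weighted by it.\<close>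

lemma weighted_marginals_eq:
  fixes M N :: "(real \<times> real) measure"
  assumes fin: "finite_measure M" "finite_measure N"
    and sets: "sets M = sets borel" "sets N = sets borel"
    and g: "g \<in> borel_measurable borel" "\<And>y::real. \<bar>g y\<bar> \<le> 1"
    and eq: "\<And>u. (CLINT z|M. iexp (u * fst z)) = (CLINT z|N. iexp (u * fst z))"
    and eqg: "\<And>u. (CLINT z|M. iexp (u * fst z) * complex_of_real (g (snd z)))
                 = (CLINT z|N. iexp (u * fst z) * complex_of_real (g (snd z)))"
    and X: "X \<in> sets (borel :: real measure)"
  shows "(LINT z|M. indicator X (fst z) * g (snd z)) = (LINT z|N. indicator X (fst z) * g (snd z))"
proof -
  note [measurable] = g(1) X
  define K where "K h L = distr (density L (\<lambda>z. ennreal (1 + h (snd z)))) borel fst"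
    for h :: "real \<Rightarrow> real" and L :: "(real \<times> real) measure"
  \<comment> \<open>Stated for an arbitrary bounded \<open>h\<close> because it is used twice, with
    \<open>h = g\<close> and with \<open>h = 0\<close>; the difference of the two instances isolates
    the integral weighted by \<open>g\<close> alone.\<close>
  have *: "(LINT z|M. indicator X (fst z) * (1 + h (snd z)))
      = (LINT z|N. indicator X (fst z) * (1 + h (snd z)))"
    if h[measurable]: "h \<in> borel_measurable borel" and h1: "\<And>y. \<bar>h y\<bar> \<le> 1"
      and eqh: "\<And>u. (CLINT z|M. iexp (u * fst z) * complex_of_real (h (snd z)))
                 = (CLINT z|N. iexp (u * fst z) * complex_of_real (h (snd z)))" for h
  proof -
    have nonneg: "0 \<le> 1 + h y" for y using h1[of y] by linarith
    have h2: "\<bar>1 + h y\<bar> \<le> 2" for y using h1[of y] by linarith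
    have L: "fst \<in> borel_measurable L" "integrable L (\<lambda>z. 1 + h (snd z))"
        "char (K h L) u = (CLINT z|L. iexp (u * fst z)) + (CLINT z|L. iexp (u * fst z) * complex_of_real (h (snd z)))"
      if fL: "finite_measure L" and sL: "sets L = sets borel" for L u
    proof -
      interpret finite_measure L by fact
      note sL[measurable_cong]
      show m: "fst \<in> borel_measurable L" by (simp add: measurable_cong_sets[OF sL refl] borel_prod[symmetric])
      have m': "snd \<in> borel_measurable L" by (simp add: measurable_cong_sets[OF sL refl] borel_prod[symmetric])
      note [measurable] = m m'
      show i: "integrable L (\<lambda>z. 1 + h (snd z))"
        by (rule integrable_const_bound[where B=2]) (auto simp: h2)
      have "char (K h L) u = (CLINT z|L. iexp (u * fst z) * complex_of_real (1 + h (snd z)))"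
        unfolding K_def by (rule char_distr_density_real) (auto simp: nonneg)
      also have "\<dots> = (CLINT z|L. iexp (u * fst z) + iexp (u * fst z) * complex_of_real (h (snd z)))"
        by (simp add: algebra_simps)
      also have "\<dots> = (CLINT z|L. iexp (u * fst z)) + (CLINT z|L. iexp (u * fst z) * complex_of_real (h (snd z)))"
        by (rule Bochner_Integration.integral_add)
          (auto intro!: integrable_const_bound[where B=1] simp: norm_mult h1)
      finally show "char (K h L) u = \<dots>" .
    qed
    have "K h M = K h N"
    proof (rule finite_measure_eqI_char)
      show "finite_measure (K h M)" "finite_measure (K h N)"
        unfolding K_def using L fin sets nonneg
        by (auto intro!: finite_measure_distr_density_real)
      show "char (K h M) = char (K h N)"
        by (rule ext) (simp only: L(3)[OF fin(1) sets(1)] L(3)[OF fin(2) sets(2)] eq eqh)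
    qed (simp_all add: K_def)
    then have "emeasure (K h M) X = emeasure (K h N) X" by simp
    then have "ennreal (LINT z|M. indicator X (fst z) * (1 + h (snd z)))
        = ennreal (LINT z|N. indicator X (fst z) * (1 + h (snd z)))"
      unfolding K_def using L fin sets nonneg X by (simp add: emeasure_distr_density_real)
    then show ?thesis using nonneg by (simp add: ennreal_inj)
  qed
  have split: "(LINT z|L. indicator X (fst z) * (1 + g (snd z)))
      = (LINT z|L. indicator X (fst z) * (1 + 0)) + (LINT z|L. indicator X (fst z) * g (snd z))"
    if fL: "finite_measure L" and sL: "sets L = sets borel" for L
  proof -
    interpret finite_measure L by fact
    have [measurable]: "fst \<in> borel_measurable L" "snd \<in> borel_measurable L"
      by (simp_all add: measurable_cong_sets[OF sL refl] borel_prod[symmetric])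
    show ?thesis
      unfolding distrib_left
      by (subst Bochner_Integration.integral_add)
        (auto intro!: integrable_const_bound[where B=1] simp: g(2) indicator_def)
  qed
  show ?thesis
    using *[OF g eqg] *[of "\<lambda>_. 0"] split[OF fin(1) sets(1)] split[OF fin(2) sets(2)] by simp
qed

text \<open>Weighting by \<open>cos (v y)\<close> or \<open>sin (v y)\<close> amounts to combining the values of the
  characteristic function at \<open>(u, v)\<close> and \<open>(u, -v)\<close>.\<close>

theorem finite_measure_eqI_char_prod:
  fixes M N :: "(real \<times> real) measure"
  assumes fin: "finite_measure M" "finite_measure N"
    and sets: "sets M = sets borel" "sets N = sets borel"
    and eq: "\<And>u v. (CLINT z|M. iexp (u * fst z + v * snd z)) = (CLINT z|N. iexp (u * fst z + v * snd z))"
  shows "M = N"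
proof -
  have meas: "fst \<in> borel_measurable L" "snd \<in> borel_measurable L"
    if "sets L = sets borel" for L :: "(real \<times> real) measure"
    by (simp_all add: measurable_cong_sets[OF that refl] borel_prod[symmetric])
  have eq0: "(CLINT z|M. iexp (u * fst z)) = (CLINT z|N. iexp (u * fst z))" for u
    using eq[of u 0] by simp
  have cos_eq: "iexp (u * x) * complex_of_real (cos (v * y))
      = (iexp (u * x + v * y) + iexp (u * x + (- v) * y)) / 2" for u v x y
    by (simp add: complex_eq_iff Re_exp Im_exp cos_add sin_add cos_diff sin_diff)
  have sin_eq: "iexp (u * x) * complex_of_real (sin (v * y))
      = (iexp (u * x + v * y) - iexp (u * x + (- v) * y)) / (2 * \<i>)" for u v x y
    by (simp add: complex_eq_iff Re_exp Im_exp cos_add sin_add cos_diff sin_diff Re_divide Im_divide)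
  have int: "integrable L (\<lambda>z. iexp (u * fst z + v * snd z))"
    if "finite_measure L" "sets L = sets borel" for L u v
  proof -
    interpret finite_measure L by fact
    note [measurable] = meas[OF that(2)]
    show ?thesis by (rule integrable_const_bound[where B=1]) auto
  qed
  have cos_int: "(CLINT z|L. iexp (u * fst z) * complex_of_real (cos (v * snd z)))
      = ((CLINT z|L. iexp (u * fst z + v * snd z)) + (CLINT z|L. iexp (u * fst z + (- v) * snd z))) / 2"
    and sin_int: "(CLINT z|L. iexp (u * fst z) * complex_of_real (sin (v * snd z)))
      = ((CLINT z|L. iexp (u * fst z + v * snd z)) - (CLINT z|L. iexp (u * fst z + (- v) * snd z))) / (2 * \<i>)"
    if "finite_measure L" "sets L = sets borel" for L u v
    unfolding cos_eq sin_eq integral_divide_zero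
    by (simp_all only: Bochner_Integration.integral_add[OF int[OF that] int[OF that]]
      Bochner_Integration.integral_diff[OF int[OF that] int[OF that]])
  \<comment> \<open>Second use of the one-dimensional theorem, now with the first coordinate as
    weight. For fixed \<open>X\<close>, the real and imaginary parts of the characteristic function
    of \<open>K L\<close> are the integrals with weights \<open>cos\<close> and \<open>sin\<close>
    that \<open>weighted_marginals_eq\<close> compares.\<close>
  have rect: "emeasure M (X \<times> Y) = emeasure N (X \<times> Y)"
    if X[measurable]: "X \<in> sets borel" and Y[measurable]: "Y \<in> sets borel" for X Y
  proof -
    define K where "K L = distr (density L (\<lambda>z. ennreal (indicator X (fst z)))) borel snd"
      for L :: "(real \<times> real) measure"
    have L: "finite_measure (K L)" "emeasure (K L) Y = emeasure L (X \<times> Y)"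
        "char (K L) v = Complex (LINT z|L. indicator X (fst z) * cos (v * snd z))
                                (LINT z|L. indicator X (fst z) * sin (v * snd z))"
      if fL: "finite_measure L" and sL: "sets L = sets borel" for L v
    proof -
      interpret finite_measure L by fact
      note [measurable] = meas[OF sL]
      have i: "integrable L (\<lambda>z. indicator X (fst z) :: real)"
        by (rule integrable_const_bound[where B=1]) (auto simp: indicator_def)
      show "finite_measure (K L)"
        unfolding K_def by (rule finite_measure_distr_density_real[OF i]) auto
      have "emeasure (K L) Y = ennreal (LINT z|L. indicator Y (snd z) * indicator X (fst z))"
        unfolding K_def by (rule emeasure_distr_density_real[OF i]) auto
      also have "(LINT z|L. indicator Y (snd z) * indicator X (fst z)) = (LINT z|L. indicator (X \<times> Y) z :: real)"
        by (rule Bochner_Integration.integral_cong) (auto simp: indicator_def)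
      also have "\<dots> = measure L (X \<times> Y)"
      proof -
        have "X \<times> Y \<in> sets L" using X Y by (simp add: sL borel_prod[symmetric])
        then show ?thesis by simp
      qed
      finally show "emeasure (K L) Y = emeasure L (X \<times> Y)" by (simp add: emeasure_eq_measure)
      have "char (K L) v = (CLINT z|L. iexp (v * snd z) * complex_of_real (indicator X (fst z)))"
        unfolding K_def by (rule char_distr_density_real) auto
      also have "\<dots> = (CLINT z|L. complex_of_real (indicator X (fst z) * cos (v * snd z))
          + \<i> * complex_of_real (indicator X (fst z) * sin (v * snd z)))"
        by (rule Bochner_Integration.integral_cong) (auto simp: complex_eq_iff Re_exp Im_exp)
      also have "\<dots> = complex_of_real (LINT z|L. indicator X (fst z) * cos (v * snd z))
          + \<i> * complex_of_real (LINT z|L. indicator X (fst z) * sin (v * snd z))"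
      proof -
        have "integrable L (\<lambda>z. indicator X (fst z) * cos (v * snd z))"
          "integrable L (\<lambda>z. indicator X (fst z) * sin (v * snd z))"
          by (auto intro!: integrable_const_bound[where B=1] simp: indicator_def)
        then show ?thesis
          by (subst Bochner_Integration.integral_add) (auto simp del: of_real_mult)
      qed
      finally show "char (K L) v = Complex (LINT z|L. indicator X (fst z) * cos (v * snd z))
                                (LINT z|L. indicator X (fst z) * sin (v * snd z))"
        by (simp add: Complex_eq)
    qed
    have "K M = K N"
    proof (rule finite_measure_eqI_char)
      show "finite_measure (K M)" "finite_measure (K N)" using L fin sets by auto
      have c: "(CLINT z|M. iexp (u * fst z) * complex_of_real (cos (v * snd z)))
            = (CLINT z|N. iexp (u * fst z) * complex_of_real (cos (v * snd z)))"
        and s: "(CLINT z|M. iexp (u * fst z) * complex_of_real (sin (v * snd z)))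
            = (CLINT z|N. iexp (u * fst z) * complex_of_real (sin (v * snd z)))" for u v
        by (simp_all only: cos_int[OF fin(1) sets(1)] cos_int[OF fin(2) sets(2)]
            sin_int[OF fin(1) sets(1)] sin_int[OF fin(2) sets(2)] eq)
      have cs: "(LINT z|M. indicator X (fst z) * cos (v * snd z)) = (LINT z|N. indicator X (fst z) * cos (v * snd z))"
          "(LINT z|M. indicator X (fst z) * sin (v * snd z)) = (LINT z|N. indicator X (fst z) * sin (v * snd z))" for v
        using weighted_marginals_eq[OF fin sets _ _ eq0 c X] weighted_marginals_eq[OF fin sets _ _ eq0 s X]
        by simp_all
      show "char (K M) = char (K N)"
        by (rule ext) (simp only: L(3)[OF fin(1) sets(1)] L(3)[OF fin(2) sets(2)] cs)
    qed (simp_all add: K_def)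
    then show ?thesis using L(2) fin sets by metis
  qed
  \<comment> \<open>Measurable rectangles are stable under intersection, generate the Borel sets of
    the plane and include the whole plane, which has finite mass; agreement on them therefore
    suffices.\<close>
  let ?E = "{a \<times> b | a b. a \<in> sets (borel::real measure) \<and> b \<in> sets (borel::real measure)}"
  have gen: "sets L = sigma_sets UNIV ?E" if "sets L = sets borel" for L :: "(real \<times> real) measure"
    by (simp add: that borel_prod[symmetric] sets_pair_measure)
  show ?thesis
  proof (rule measure_eqI_generator_eq[where A="\<lambda>_. UNIV" and \<Omega>=UNIV and E="?E"])
    show "Int_stable ?E" by (rule Int_stable_pair_measure_generator)
    have "UNIV \<in> ?E" by (intro CollectI exI[of _ UNIV]) simp
    then show "range (\<lambda>_. UNIV) \<subseteq> ?E" by auto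
    show "emeasure M UNIV \<noteq> \<infinity>"
      using fin(1) by (simp add: finite_measure.emeasure_eq_measure)
    show "sets M = sigma_sets UNIV ?E" "sets N = sigma_sets UNIV ?E"
      by (rule gen, rule sets)+
    show "emeasure M Z = emeasure N Z" if "Z \<in> ?E" for Z
      using that rect by blast
  qed simp_all
qed

text \<open>The characteristic function of a planar law at \<open>(u, v)\<close> is that of the
  projection \<open>u * fst z + v * snd z\<close> at 1.\<close>

corollary cramer_wold_prod:
  fixes M N :: "(real \<times> real) measure"
  assumes fin: "finite_measure M" "finite_measure N"
    and sets: "sets M = sets borel" "sets N = sets borel"
    and eq: "\<And>u v. distr M borel (\<lambda>z. u * fst z + v * snd z) = distr N borel (\<lambda>z. u * fst z + v * snd z)"
  shows "M = N"
proof (rule finite_measure_eqI_char_prod[OF fin sets])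
  fix u v
  have *: "(CLINT z|L. iexp (u * fst z + v * snd z)) = (CLINT x|distr L borel (\<lambda>z. u * fst z + v * snd z). iexp x)"
    if "sets L = sets borel" for L :: "(real \<times> real) measure"
  proof -
    have [measurable]: "fst \<in> borel_measurable L" "snd \<in> borel_measurable L"
      by (simp_all add: measurable_cong_sets[OF that refl] borel_prod[symmetric])
    show ?thesis by (subst integral_distr) simp_all
  qed
  show "(CLINT z|M. iexp (u * fst z + v * snd z)) = (CLINT z|N. iexp (u * fst z + v * snd z))"
    by (simp only: *[OF sets(1)] *[OF sets(2)] eq)
qed

section \<open>Normal laws on the line, point masses included\<close>

text \<open>One formula for both branches of \<open>normal_law\<close>: for \<open>v = 0\<close> the
  affine map is constant and its image law is the point mass. Integrals can thus be moved to the
  standard normal law without a case distinction.\<close>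

lemma normal_law_eq_distr_std_normal:
  assumes "0 \<le> v"
  shows "normal_law m v = distr std_normal_distribution borel (\<lambda>x. m + sqrt v * x)"
proof (cases "v = 0")
  case True
  interpret prob_space std_normal_distribution by (rule prob_space_std_normal)
  show ?thesis using True by (simp add: normal_law_def)
next
  case False
  interpret prob_space std_normal_distribution by (rule prob_space_std_normal)
  have v: "0 < v" using False assms by simp
  have "distributed std_normal_distribution lborel (\<lambda>x. x) std_normal_density"
    by (auto simp: distributed_def distr_id2 sets_density)
  from normal_density_affine[OF this, of "sqrt v" m] v
  have "distr std_normal_distribution lborel (\<lambda>x. m + sqrt v * x) = density lborel (normal_density m (sqrt v))"
    by (simp add: distributed_def)
  moreover have "distr std_normal_distribution borel (\<lambda>x. m + sqrt v * x)
      = distr std_normal_distribution lborel (\<lambda>x. m + sqrt v * x)"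
    by (rule distr_cong) simp_all
  ultimately show ?thesis using False by (simp only: normal_law_def if_False)
qed

text \<open>The characteristic function of the standard normal law depends only on the square of its
  argument, so the sign of \<open>q\<close> disappears and \<open>q = 0\<close> needs no separate
  treatment. This settles the centred case; a translation supplies the mean.\<close>

lemma distr_affine_normal_law:
  assumes "0 \<le> v"
  shows "distr (normal_law m v) borel (\<lambda>x. p + q * x) = normal_law (p + q * m) (q\<^sup>2 * v)"
proof -
  have *: "distr (normal_law 0 w) borel (\<lambda>x. r + x) = normal_law r w" if "0 \<le> w" for r w
    using that by (simp add: normal_law_eq_distr_std_normal distr_distr comp_def)
  let ?D = "distr std_normal_distribution borel (\<lambda>x. (q * sqrt v) * x)"
  have "?D = normal_law 0 (q\<^sup>2 * v)"
  proof (rule Levy_uniqueness)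
    interpret prob_space std_normal_distribution by (rule prob_space_std_normal)
    show "real_distribution ?D"
      unfolding real_distribution_def real_distribution_axioms_def by (auto intro!: prob_space_distr)
    show "real_distribution (normal_law 0 (q\<^sup>2 * v))"
      using assms by (intro real_distribution_normal_law) simp
    show "char ?D = char (normal_law 0 (q\<^sup>2 * v))"
    proof
      fix t
      have "char ?D t = char std_normal_distribution (q * sqrt v * t)"
        unfolding char_def by (subst integral_distr) (auto simp: mult_ac)
      then show "char ?D t = char (normal_law 0 (q\<^sup>2 * v)) t"
        using assms by (simp add: char_normal_law char_std_normal_distribution power_mult_distrib)
    qed
  qed
  then have "normal_law (p + q * m) (q\<^sup>2 * v) = distr ?D borel (\<lambda>x. (p + q * m) + x)"
    using *[of "q\<^sup>2 * v" "p + q * m"] assms by simp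
  also have "\<dots> = distr (normal_law m v) borel (\<lambda>x. p + q * x)"
    using assms by (simp add: normal_law_eq_distr_std_normal distr_distr comp_def algebra_simps)
  finally show ?thesis ..
qed

lemma char_normal_law_mean:
  assumes "0 \<le> v"
  shows "char (normal_law m v) t = iexp (t * m) * exp (- (v * t\<^sup>2) / 2)"
proof -
  have [measurable_cong]: "sets (normal_law 0 v) = sets borel" by (simp add: normal_law_def)
  have *: "normal_law m v = distr (normal_law 0 v) borel (\<lambda>x. m + x)"
    using assms distr_affine_normal_law[of v 0 m 1] by simp
  have "char (normal_law m v) t = (CLINT x|normal_law 0 v. iexp (t * (m + x)))"
    unfolding char_def * by (subst integral_distr) simp_all
  also have "\<dots> = (CLINT x|normal_law 0 v. iexp (t * m) * iexp (t * x))"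
    by (simp add: mult_exp_exp distrib_left)
  also have "\<dots> = iexp (t * m) * char (normal_law 0 v) t"
    unfolding char_def by simp
  finally show ?thesis using assms by (simp add: char_normal_law)
qed

text \<open>Characteristic functions multiply under independence and the exponents add. Unlike a
  convolution of densities, this also covers variance 0.\<close>

lemma (in prob_space) distr_add_normal_law:
  assumes ind: "indep_var borel X borel Y"
    and X: "distr M borel X = normal_law m v" and Y: "distr M borel Y = normal_law m' v'"
    and v: "0 \<le> v" "0 \<le> v'"
  shows "distr M borel (\<lambda>\<omega>. X \<omega> + Y \<omega>) = normal_law (m + m') (v + v')"
proof (rule Levy_uniqueness)
  have [measurable]: "random_variable borel X" "random_variable borel Y"
    using ind by (auto dest: indep_var_rv1 indep_var_rv2)
  show "real_distribution (distr M borel (\<lambda>\<omega>. X \<omega> + Y \<omega>))"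
    unfolding real_distribution_def real_distribution_axioms_def by (auto intro!: prob_space_distr)
  show "real_distribution (normal_law (m + m') (v + v'))"
    using v by (intro real_distribution_normal_law) simp
  show "char (distr M borel (\<lambda>\<omega>. X \<omega> + Y \<omega>)) = char (normal_law (m + m') (v + v'))"
  proof
    fix t
    have "iexp (t * (m + m')) = iexp (t * m) * iexp (t * m')"
      by (simp add: exp_add[symmetric] distrib_left)
    moreover have "exp (- ((v + v') * t\<^sup>2) / 2) = exp (- (v * t\<^sup>2) / 2) * exp (- (v' * t\<^sup>2) / 2)"
      by (simp add: exp_add[symmetric] distrib_right add_divide_distrib)
    ultimately show "char (distr M borel (\<lambda>\<omega>. X \<omega> + Y \<omega>)) t = char (normal_law (m + m') (v + v')) t"
      using v by (simp only: char_distr_add[OF ind] X Y char_normal_law_mean add_nonneg_nonneg of_real_mult mult_ac)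
  qed
qed

text \<open>Shows that the mean is determined by the law, so that two descriptions of the same law
  must have equal means.\<close>

lemma normal_law_mean:
  assumes "0 \<le> v" shows "(LINT x|normal_law m v. x) = m"
proof -
  interpret prob_space std_normal_distribution by (rule prob_space_std_normal)
  have 0: "LINT x|std_normal_distribution. x = 0" and i: "integrable std_normal_distribution (\<lambda>x. x)"
    using integral_std_normal_distribution_moment_odd[of 1] integrable_std_normal_distribution_moment[of 1]
    by simp_all
  have "(LINT x|normal_law m v. x) = (LINT x|std_normal_distribution. m + sqrt v * x)"
    unfolding normal_law_eq_distr_std_normal[OF assms] by (subst integral_distr) simp_all
  also have "\<dots> = (LINT x|std_normal_distribution. m) + (LINT x|std_normal_distribution. sqrt v * x)"
    using i by (intro Bochner_Integration.integral_add) auto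
  also have "\<dots> = m"
    using prob_space by (simp only: lebesgue_integral_const Bochner_Integration.integral_mult_right_zero 0) simp
  finally show ?thesis .
qed

text \<open>A half-line of mass 0 under an everywhere positive density would be Lebesgue
  null.\<close>

lemma Phi_pos: "0 < Phi a"
proof -
  interpret prob_space std_normal_distribution by (rule prob_space_std_normal)
  have "emeasure std_normal_distribution {..a} \<noteq> 0"
  proof
    assume "emeasure std_normal_distribution {..a} = 0"
    then have "{..a} \<in> null_sets std_normal_distribution" by (simp add: null_sets_def)
    then have "AE x in lborel. x \<in> {..a} \<longrightarrow> ennreal (std_normal_density x) = 0"
      by (subst (asm) null_sets_density_iff) auto
    then have "AE x in lborel. x \<notin> {..a}"
      by eventually_elim (use normal_density_pos[of 1 0] in \<open>auto simp: ennreal_eq_0_iff not_le[symmetric]\<close>)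
    then have "{..a} \<in> null_sets lborel"
      by (simp add: AE_iff_null_sets)
    \<comment> \<open>Any interval of positive length inside the half-line would do; this one has
      length 1.\<close>
    moreover have "emeasure lborel {a - 1..a} \<le> emeasure lborel {..a}" by (intro emeasure_mono) auto
    ultimately show False by (simp add: null_sets_def)
  qed
  then show ?thesis
    unfolding Phi_def cdf_def by (simp add: emeasure_eq_measure zero_less_measure_iff)
qed

section \<open>Covariance and correlation under affine maps and change of space\<close>

text \<open>The shifts cancel against the means, which requires integrability of \<open>X\<close>
  and \<open>Y\<close>. The factor \<open>p * q\<close> leaves the Bochner integral whether or not
  the product is integrable.\<close>

lemma covariance_affine:
  assumes "prob_space M" "integrable M X" "integrable M Y"
  shows "covariance M (\<lambda>\<omega>. m + p * X \<omega>) (\<lambda>\<omega>. m' + q * Y \<omega>) = p * q * covariance M X Y"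
proof -
  interpret prob_space M by fact
  have "(m + p * X \<omega> - (LINT \<omega>|M. m + p * X \<omega>)) * (m' + q * Y \<omega> - (LINT \<omega>|M. m' + q * Y \<omega>))
      = (p * q) * ((X \<omega> - (LINT \<omega>|M. X \<omega>)) * (Y \<omega> - (LINT \<omega>|M. Y \<omega>)))" for \<omega>
    using assms(2,3) by (simp add: prob_space algebra_simps)
  then show ?thesis unfolding covariance_def by simp
qed

lemma correlation_affine:
  assumes "prob_space M" "integrable M X" "integrable M Y" "0 < p" "0 < q"
  shows "correlation M (\<lambda>\<omega>. m + p * X \<omega>) (\<lambda>\<omega>. m' + q * Y \<omega>) = correlation M X Y"
proof -
  have "p * p * covariance M X X * (q * q * covariance M Y Y)
      = (p * q)\<^sup>2 * (covariance M X X * covariance M Y Y)"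
    by (simp add: power2_eq_square)
  then show ?thesis
    using assms unfolding correlation_def
    by (simp add: covariance_affine real_sqrt_mult)
qed

lemma correlation_distr:
  assumes [measurable]: "X \<in> borel_measurable M" "Y \<in> borel_measurable M"
  shows "correlation M X Y = correlation (distr M borel (\<lambda>\<omega>. (X \<omega>, Y \<omega>))) fst snd"
  unfolding correlation_def covariance_def borel_prod[symmetric]
  by (simp add: integral_distr)

section \<open>Gaussian pairs with common mean and variance\<close>

text \<open>Separates the bivariate argument from the state process. Prescribing the laws of all
  linear combinations is the form that Cramer-Wold consumes, and it admits the degenerate cases
  \<open>\<bar>\<rho>\<bar> = 1\<close>, where no joint density exists.\<close>

locale gaussian_pair = prob_space M for M :: "'w measure" +
  fixes X Y :: "'w \<Rightarrow> real" and m \<sigma> \<rho> :: real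
  assumes X_measurable [measurable]: "X \<in> borel_measurable M"
    and Y_measurable [measurable]: "Y \<in> borel_measurable M"
    and \<sigma>_pos: "0 < \<sigma>" and \<rho>_le: "\<bar>\<rho>\<bar> \<le> 1"
    and lincomb: "\<And>u v. distr M borel (\<lambda>\<omega>. u * X \<omega> + v * Y \<omega>)
      = normal_law ((u + v) * m) (\<sigma>\<^sup>2 * (u\<^sup>2 + v\<^sup>2 + 2 * \<rho> * u * v))"
begin

lemma quadratic_nonneg: "0 \<le> u\<^sup>2 + v\<^sup>2 + 2 * \<rho> * u * v"
proof -
  have "u\<^sup>2 + v\<^sup>2 + 2 * \<rho> * u * v = (u + \<rho> * v)\<^sup>2 + (1 - \<rho>\<^sup>2) * v\<^sup>2"
    by (simp add: power2_eq_square algebra_simps)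
  then show ?thesis using \<rho>_le by (simp add: abs_square_le_1)
qed

lemma jointly_gaussian: "jointly_gaussian M X Y"
proof -
  define S :: "real^2^2" where "S = vector [vector [\<sigma>\<^sup>2, \<sigma>\<^sup>2 * \<rho>], vector [\<sigma>\<^sup>2 * \<rho>, \<sigma>\<^sup>2]]"
  have S: "u \<bullet> (S *v u) = \<sigma>\<^sup>2 * ((u$1)\<^sup>2 + (u$2)\<^sup>2 + 2 * \<rho> * u$1 * u$2)" for u
    by (simp add: S_def inner_vec_def matrix_vector_mult_def sum_2 power2_eq_square algebra_simps)
  have "transpose S = S" by (simp add: S_def transpose_def vec_eq_iff forall_2)
  then have "psd S" by (simp add: psd_def S quadratic_nonneg)
  moreover have "(\<lambda>\<omega>. vector [X \<omega>, Y \<omega>] :: real^2) \<in> borel_measurable M"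
  proof (subst borel_measurable_euclidean_space, intro ballI)
    fix i :: "real^2" assume "i \<in> Basis"
    have "(\<lambda>\<omega>. (vector [X \<omega>, Y \<omega>] :: real^2) \<bullet> i) = (\<lambda>\<omega>. X \<omega> * i$1 + Y \<omega> * i$2)"
      by (simp add: inner_vec_def sum_2)
    then show "(\<lambda>\<omega>. (vector [X \<omega>, Y \<omega>] :: real^2) \<bullet> i) \<in> borel_measurable M" by simp
  qed
  moreover have "distr M borel (\<lambda>\<omega>. u \<bullet> (vector [X \<omega>, Y \<omega>] :: real^2))
      = normal_law (u \<bullet> vector [m, m]) (u \<bullet> (S *v u))" for u
    using lincomb[of "u$1" "u$2"] unfolding S by (simp add: inner_vec_def sum_2 algebra_simps)
  ultimately show ?thesis unfolding jointly_gaussian_def multivariate_normal_def by blast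
qed

definition X' where "X' \<omega> = (X \<omega> - m) / \<sigma>"
definition Y' where "Y' \<omega> = (Y \<omega> - m) / \<sigma>"

lemma standardised_measurable [measurable]: "X' \<in> borel_measurable M" "Y' \<in> borel_measurable M"
  unfolding X'_def[abs_def] Y'_def[abs_def] by simp_all

text \<open>The combination is an affine image of \<open>u * X + v * Y\<close>: the shift
  \<open>?p\<close> cancels the mean and the factor \<open>1 / \<sigma>\<close> cancels
  \<open>\<sigma>\<^sup>2\<close>.\<close>

lemma standardised_lincomb:
  "distr M borel (\<lambda>\<omega>. u * X' \<omega> + v * Y' \<omega>) = normal_law 0 (u\<^sup>2 + v\<^sup>2 + 2 * \<rho> * u * v)"
proof -
  let ?q = "u\<^sup>2 + v\<^sup>2 + 2 * \<rho> * u * v" and ?p = "- ((u + v) * m / \<sigma>)"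
  have "distr M borel (\<lambda>\<omega>. u * X' \<omega> + v * Y' \<omega>)
      = distr (distr M borel (\<lambda>\<omega>. u * X \<omega> + v * Y \<omega>)) borel (\<lambda>x. ?p + (1 / \<sigma>) * x)"
    using \<sigma>_pos by (subst distr_distr)
      (auto simp: comp_def X'_def Y'_def field_simps intro!: distr_cong)
  also have "\<dots> = normal_law (?p + (1 / \<sigma>) * ((u + v) * m)) ((1 / \<sigma>)\<^sup>2 * (\<sigma>\<^sup>2 * ?q))"
    unfolding lincomb by (rule distr_affine_normal_law) (simp add: quadratic_nonneg)
  also have "\<dots> = normal_law 0 ?q"
    using \<sigma>_pos by (simp add: power_divide)
  finally show ?thesis .
qed

lemma standardised_law: "distr M borel (\<lambda>\<omega>. (X' \<omega>, Y' \<omega>)) = std_bivariate_normal \<rho>"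
proof (rule cramer_wold_prod)
  have [measurable]: "(\<lambda>\<omega>. (X' \<omega>, Y' \<omega>)) \<in> measurable M borel"
    unfolding borel_prod[symmetric] by measurable
  show "finite_measure (distr M borel (\<lambda>\<omega>. (X' \<omega>, Y' \<omega>)))"
    by (intro finite_measure_distr) measurable
  interpret P: pair_prob_space std_normal_distribution std_normal_distribution
    by (rule pair_prob_space_std_normal)
  show "finite_measure (std_bivariate_normal \<rho>)"
    unfolding std_bivariate_normal_def
    by (intro P.finite_measure_distr) (simp add: borel_prod[symmetric])
  fix u v
  show "distr (distr M borel (\<lambda>\<omega>. (X' \<omega>, Y' \<omega>))) borel (\<lambda>z. u * fst z + v * snd z)
      = distr (std_bivariate_normal \<rho>) borel (\<lambda>z. u * fst z + v * snd z)"
    using standardised_lincomb[of u v] distr_lincomb_std_bivariate_normal[OF \<rho>_le, of u v]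
    by (subst distr_distr) (auto simp: comp_def borel_prod[symmetric])
qed simp_all

lemma standardised_marginals:
  "distr M borel X' = std_normal_distribution" "distr M borel Y' = std_normal_distribution"
  using standardised_lincomb[of 1 0] standardised_lincomb[of 0 1] by (simp_all add: normal_law_std)

text \<open>Correlation is invariant under increasing affine maps and depends only on the joint law,
  so it can be computed for \<open>std_bivariate_normal \<rho>\<close>.\<close>

lemma correlation_eq: "correlation M X Y = \<rho>"
proof -
  have i: "integrable std_normal_distribution (\<lambda>x. x)"
    using integrable_std_normal_distribution_moment[of 1] by simp
  have "integrable M X'" "integrable M Y'"
    using integrable_distr[OF standardised_measurable(1), of "\<lambda>x. x"]
      integrable_distr[OF standardised_measurable(2), of "\<lambda>x. x"] i
    unfolding standardised_marginals by blast+
  then have "correlation M (\<lambda>\<omega>. m + \<sigma> * X' \<omega>) (\<lambda>\<omega>. m + \<sigma> * Y' \<omega>) = correlation M X' Y'"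
    by (intro correlation_affine prob_space_axioms \<sigma>_pos)
  moreover have "(\<lambda>\<omega>. m + \<sigma> * X' \<omega>) = X" "(\<lambda>\<omega>. m + \<sigma> * Y' \<omega>) = Y"
    using \<sigma>_pos by (auto simp: X'_def Y'_def)
  ultimately have "correlation M X Y = correlation M X' Y'" by simp
  also have "\<dots> = \<rho>"
    by (simp add: correlation_distr standardised_law correlation_std_bivariate_normal[OF \<rho>_le])
  finally show ?thesis .
qed

text \<open>Both switching events have probability \<open>Phi a - Phi2 a a \<rho>\<close>, since the
  standardised marginals coincide; only the conditioning events differ.\<close>

lemma switching_probabilities:
  fixes \<Delta> :: real
  defines "a \<equiv> (\<Delta> - m) / \<sigma>"
  shows "\<P>(\<omega> in M. Y \<omega> \<ge> \<Delta> \<bar> X \<omega> < \<Delta>) = 1 - Phi2 a a \<rho> / Phi a"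
    and "\<P>(\<omega> in M. Y \<omega> < \<Delta> \<bar> X \<omega> \<ge> \<Delta>) = (Phi a - Phi2 a a \<rho>) / (1 - Phi a)"
proof -
  have X: "X \<omega> < \<Delta> \<longleftrightarrow> X' \<omega> < a" and Y: "Y \<omega> < \<Delta> \<longleftrightarrow> Y' \<omega> < a" for \<omega>
    using \<sigma>_pos by (auto simp: X'_def Y'_def a_def divide_less_cancel)
  have marg: "prob {\<omega> \<in> space M. Z \<omega> < a} = Phi a" "AE \<omega> in M. Z \<omega> \<noteq> a"
    if [measurable]: "Z \<in> borel_measurable M" and Z: "distr M borel Z = std_normal_distribution" for Z
  proof -
    \<comment> \<open>Points are Lebesgue null. Hence the strict inequalities of the events may be
      exchanged for the weak ones in \<open>Phi\<close> and \<open>Phi2\<close>.\<close>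
    have "AE z in std_normal_distribution. z \<noteq> a"
      by (subst AE_density) (auto intro: AE_mp[OF AE_lborel_singleton[of a]])
    then have "AE z in distr M borel Z. z \<noteq> a" by (simp only: Z)
    then show ae: "AE \<omega> in M. Z \<omega> \<noteq> a" by (subst (asm) AE_distr_iff) simp_all
    have "prob {\<omega> \<in> space M. Z \<omega> < a} = prob {\<omega> \<in> space M. Z \<omega> \<le> a}"
      by (rule finite_measure_eq_AE) (use ae in auto)
    also have "\<dots> = measure (distr M borel Z) {..a}"
      by (subst measure_distr) (auto simp: vimage_def Int_def conj_commute)
    also have "\<dots> = Phi a" by (simp add: Z Phi_def cdf_def)
    finally show "prob {\<omega> \<in> space M. Z \<omega> < a} = Phi a" .
  qed
  note mX = marg[OF standardised_measurable(1) standardised_marginals(1)]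
    and mY = marg[OF standardised_measurable(2) standardised_marginals(2)]
  have both: "prob {\<omega> \<in> space M. Y' \<omega> < a \<and> X' \<omega> < a} = Phi2 a a \<rho>"
  proof -
    have [measurable]: "(\<lambda>\<omega>. (X' \<omega>, Y' \<omega>)) \<in> measurable M borel"
      unfolding borel_prod[symmetric] by measurable
    have "prob {\<omega> \<in> space M. Y' \<omega> < a \<and> X' \<omega> < a} = prob {\<omega> \<in> space M. X' \<omega> \<le> a \<and> Y' \<omega> \<le> a}"
      by (rule finite_measure_eq_AE) (use mX(2) mY(2) in auto)
    also have "\<dots> = measure (distr M borel (\<lambda>\<omega>. (X' \<omega>, Y' \<omega>))) ({..a} \<times> {..a})"
      by (subst measure_distr) (auto simp: vimage_def Int_def conj_commute borel_prod[symmetric] intro: arg_cong[where f=prob])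
    finally show ?thesis by (simp add: standardised_law Phi2_def)
  qed
  have "prob {\<omega> \<in> space M. \<not> Y' \<omega> < a \<and> X' \<omega> < a}
      = prob ({\<omega> \<in> space M. X' \<omega> < a} - {\<omega> \<in> space M. Y' \<omega> < a \<and> X' \<omega> < a})"
    by (rule arg_cong[where f=prob]) auto
  also have "\<dots> = Phi a - Phi2 a a \<rho>"
    by (subst finite_measure_Diff) (auto simp: mX both)
  finally have up: "prob {\<omega> \<in> space M. \<not> Y' \<omega> < a \<and> X' \<omega> < a} = Phi a - Phi2 a a \<rho>" .
  have "prob {\<omega> \<in> space M. Y' \<omega> < a \<and> \<not> X' \<omega> < a}
      = prob ({\<omega> \<in> space M. Y' \<omega> < a} - {\<omega> \<in> space M. Y' \<omega> < a \<and> X' \<omega> < a})"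
    by (rule arg_cong[where f=prob]) auto
  also have "\<dots> = Phi a - Phi2 a a \<rho>"
    by (subst finite_measure_Diff) (auto simp: mY both)
  finally have down: "prob {\<omega> \<in> space M. Y' \<omega> < a \<and> \<not> X' \<omega> < a} = Phi a - Phi2 a a \<rho>" .
  have compl: "prob {\<omega> \<in> space M. \<not> X' \<omega> < a} = 1 - Phi a"
    by (subst prob_neg) (simp_all add: mX)
  \<comment> \<open>Splitting the quotient leaves \<open>Phi a / Phi a\<close>, which is 1 by
    \<open>Phi_pos\<close>. The second formula is directly the quotient of \<open>down\<close> and
    \<open>compl\<close>.\<close>
  show "\<P>(\<omega> in M. Y \<omega> \<ge> \<Delta> \<bar> X \<omega> < \<Delta>) = 1 - Phi2 a a \<rho> / Phi a"
    using Phi_pos[of a] by (simp add: cond_prob_def X Y mX up not_less[symmetric] diff_divide_distrib)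
  show "\<P>(\<omega> in M. Y \<omega> < \<Delta> \<bar> X \<omega> \<ge> \<Delta>) = (Phi a - Phi2 a a \<rho>) / (1 - Phi a)"
    by (simp add: cond_prob_def X Y down compl not_less[symmetric])
qed

end

section \<open>The stationary state process observed through \<open>c\<close>\<close>

theorem mainTheorem2:
  fixes M :: "'w measure"
    and A Q Qh \<Sigma> :: "real^'n^'n"
    and \<mu>w xbar c :: "real^'n"
    and x w :: "nat \<Rightarrow> 'w \<Rightarrow> real^'n"
    and s :: "nat \<Rightarrow> 'w \<Rightarrow> real"
    and \<Delta> sbar \<sigma>s a \<rho>s :: real
  assumes "prob_space M"
    and state_eq: "\<And>k \<omega>. \<omega> \<in> space M \<Longrightarrow> x (Suc k) \<omega> = A *v x k \<omega> + w k \<omega>"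
    and noise_law: "\<And>k. multivariate_normal M (w k) \<mu>w Q"
    and noise_indep: "prob_space.indep_vars M (\<lambda>_. borel) w UNIV"
    and noise_state_indep: "\<And>k. prob_space.indep_var M borel (w k) borel (x k)"
    and sqrt_Q: "psd Qh" "Qh ** Qh = Q"
    and controllable: "controllable A Qh"
    and stable: "spectral_radius A < 1"
    and xbar: "xbar = matrix_inv (mat 1 - A) *v \<mu>w"
    and lyapunov: "\<Sigma> = A ** \<Sigma> ** transpose A + Q"
    and stationary: "\<And>k. multivariate_normal M (x k) xbar \<Sigma>"
    and c: "c \<noteq> 0"
    and s: "s = (\<lambda>k \<omega>. c \<bullet> x k \<omega>)"
    and sbar: "sbar = c \<bullet> xbar"
    and \<sigma>s: "\<sigma>s\<^sup>2 = c \<bullet> (\<Sigma> *v c)" "\<sigma>s > 0"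
    and a: "a = (\<Delta> - sbar) / \<sigma>s"
    and \<rho>s: "\<rho>s = (c \<bullet> (A ** \<Sigma> *v c)) / (c \<bullet> (\<Sigma> *v c))"
  shows "\<forall>k. jointly_gaussian M (s k) (s (Suc k))
           \<and> correlation M (s k) (s (Suc k)) = \<rho>s
           \<and> \<P>(\<omega> in M. s (Suc k) \<omega> \<ge> \<Delta> \<bar> s k \<omega> < \<Delta>) = 1 - Phi2 a a \<rho>s / Phi a
           \<and> \<P>(\<omega> in M. s (Suc k) \<omega> < \<Delta> \<bar> s k \<omega> \<ge> \<Delta>) = (Phi a - Phi2 a a \<rho>s) / (1 - Phi a)"
proof
  fix k
  interpret prob_space M by fact
  have xM [measurable]: "x i \<in> borel_measurable M" and wM [measurable]: "w i \<in> borel_measurable M"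
    and \<Sigma>_sym: "transpose \<Sigma> = \<Sigma>" and \<Sigma>_nonneg: "0 \<le> u \<bullet> (\<Sigma> *v u)" and Q_nonneg: "0 \<le> u \<bullet> (Q *v u)"
    and x_law: "distr M borel (\<lambda>\<omega>. u \<bullet> x i \<omega>) = normal_law (u \<bullet> xbar) (u \<bullet> (\<Sigma> *v u))"
    and w_law: "distr M borel (\<lambda>\<omega>. u \<bullet> w i \<omega>) = normal_law (u \<bullet> \<mu>w) (u \<bullet> (Q *v u))" for i u
    using stationary[of i] noise_law[of i] by (auto simp: multivariate_normal_def psd_def)
  \<comment> \<open>Moves \<open>A\<close> onto the functional: \<open>s (Suc k)\<close> becomes
    \<open>d \<bullet> x k + c \<bullet> w k\<close>.\<close>
  define d where "d = transpose A *v c"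
  have d: "c \<bullet> (A *v y) = d \<bullet> y" for y
    unfolding d_def by (simp add: dot_lmul_matrix[symmetric])
  have lincomb: "distr M borel (\<lambda>\<omega>. u * s k \<omega> + v * s (Suc k) \<omega>)
      = normal_law (u * sbar + v * (d \<bullet> xbar + c \<bullet> \<mu>w))
          ((u *\<^sub>R c + v *\<^sub>R d) \<bullet> (\<Sigma> *v (u *\<^sub>R c + v *\<^sub>R d)) + v\<^sup>2 * (c \<bullet> (Q *v c)))" for u v
  proof -
    \<comment> \<open>Collects everything that acts on \<open>x k\<close>; what remains acts on the
      independent vector \<open>w k\<close>.\<close>
    let ?p = "u *\<^sub>R c + v *\<^sub>R d"
    have "indep_var borel ((\<lambda>y. (v *\<^sub>R c) \<bullet> y) \<circ> w k) borel ((\<lambda>y. ?p \<bullet> y) \<circ> x k)"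
      by (rule indep_var_compose[OF noise_state_indep]) simp_all
    then have ind: "indep_var borel (\<lambda>\<omega>. (v *\<^sub>R c) \<bullet> w k \<omega>) borel (\<lambda>\<omega>. ?p \<bullet> x k \<omega>)"
      by (simp add: comp_def)
    have "distr M borel (\<lambda>\<omega>. u * s k \<omega> + v * s (Suc k) \<omega>)
        = distr M borel (\<lambda>\<omega>. (v *\<^sub>R c) \<bullet> w k \<omega> + ?p \<bullet> x k \<omega>)"
      by (rule distr_cong) (simp_all add: s state_eq d inner_add_left inner_add_right distrib_left)
    also have "\<dots> = normal_law ((v *\<^sub>R c) \<bullet> \<mu>w + ?p \<bullet> xbar)
        ((v *\<^sub>R c) \<bullet> (Q *v (v *\<^sub>R c)) + ?p \<bullet> (\<Sigma> *v ?p))"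
      by (rule distr_add_normal_law[OF ind w_law x_law Q_nonneg \<Sigma>_nonneg])
    also have "(v *\<^sub>R c) \<bullet> \<mu>w + ?p \<bullet> xbar = u * sbar + v * (d \<bullet> xbar + c \<bullet> \<mu>w)"
      by (simp add: sbar inner_add_left algebra_simps)
    also have "(v *\<^sub>R c) \<bullet> (Q *v (v *\<^sub>R c)) = v\<^sup>2 * (c \<bullet> (Q *v c))"
      by (simp add: matrix_vector_mult_scaleR power2_eq_square)
    finally show ?thesis by (simp add: add.commute)
  qed
  have variance: "(u *\<^sub>R c + v *\<^sub>R d) \<bullet> (\<Sigma> *v (u *\<^sub>R c + v *\<^sub>R d)) + v\<^sup>2 * (c \<bullet> (Q *v c))
      = \<sigma>s\<^sup>2 * (u\<^sup>2 + v\<^sup>2 + 2 * \<rho>s * u * v)" for u v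
  proof -
    have "d \<bullet> (\<Sigma> *v c) = c \<bullet> ((A ** \<Sigma>) *v c)"
      by (simp add: d[symmetric] matrix_vector_mul_assoc)
    also have "\<dots> = \<rho>s * \<sigma>s\<^sup>2"
      using \<sigma>s by (simp add: \<rho>s \<sigma>s(1)[symmetric])
    finally have dc: "d \<bullet> (\<Sigma> *v c) = \<rho>s * \<sigma>s\<^sup>2" .
    \<comment> \<open>Symmetry of \<open>\<Sigma>\<close> makes the two cross terms equal, whence
      the factor 2 in the quadratic form.\<close>
    have cd: "c \<bullet> (\<Sigma> *v d) = \<rho>s * \<sigma>s\<^sup>2"
      using dot_lmul_matrix[of c \<Sigma> d] dc \<Sigma>_sym
      by (metis inner_commute vector_transpose_matrix)
    \<comment> \<open>The Lyapunov equation tested against \<open>c\<close> turns the coefficient of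
      \<open>v\<^sup>2\<close> into the stationary variance.\<close>
    have "\<sigma>s\<^sup>2 = c \<bullet> ((A ** \<Sigma> ** transpose A + Q) *v c)"
      using \<sigma>s(1) lyapunov by simp
    also have "\<dots> = d \<bullet> (\<Sigma> *v d) + c \<bullet> (Q *v c)"
      by (simp only: matrix_vector_mult_add_rdistrib inner_add_right matrix_vector_mul_assoc[symmetric]
          d_def[symmetric] d)
    finally have Q: "c \<bullet> (Q *v c) = \<sigma>s\<^sup>2 - d \<bullet> (\<Sigma> *v d)" by simp
    show ?thesis
      by (simp add: matrix_vector_right_distrib matrix_vector_mult_scaleR inner_add_left inner_add_right
          dc cd Q \<sigma>s(1)[symmetric] power2_eq_square algebra_simps)
  qed
  have mean: "d \<bullet> xbar + c \<bullet> \<mu>w = sbar"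
  proof -
    \<comment> \<open>compare the law of \<open>s (Suc k)\<close> given by the recursion with the stationary one\<close>
    have "normal_law (d \<bullet> xbar + c \<bullet> \<mu>w) (\<sigma>s\<^sup>2) = distr M borel (\<lambda>\<omega>. 0 * s k \<omega> + 1 * s (Suc k) \<omega>)"
      by (simp only: lincomb variance) simp
    also have "\<dots> = normal_law sbar (\<sigma>s\<^sup>2)"
      using x_law[of c "Suc k"] by (simp add: s sbar \<sigma>s(1))
    finally show ?thesis by (metis normal_law_mean zero_le_power2)
  qed
  have \<rho>_le: "\<bar>\<rho>s\<bar> \<le> 1"
  proof -
    have "0 \<le> \<sigma>s\<^sup>2 * (u\<^sup>2 + v\<^sup>2 + 2 * \<rho>s * u * v)" for u v
      unfolding variance[symmetric] using \<Sigma>_nonneg Q_nonneg by simp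
    then have "0 \<le> u\<^sup>2 + v\<^sup>2 + 2 * \<rho>s * u * v" for u v
      using \<sigma>s(2) by (simp add: zero_le_mult_iff)
    \<comment> \<open>Sum and difference of the pair give \<open>2 + 2 * \<rho>s\<close> and
      \<open>2 - 2 * \<rho>s\<close>, both nonnegative.\<close>
    from this[of 1 1] this[of 1 "- 1"] show ?thesis by simp
  qed
  interpret gaussian_pair M "s k" "s (Suc k)" sbar \<sigma>s \<rho>s
  proof
    show "s k \<in> borel_measurable M" "s (Suc k) \<in> borel_measurable M" by (simp_all add: s)
    show "distr M borel (\<lambda>\<omega>. u * s k \<omega> + v * s (Suc k) \<omega>)
        = normal_law ((u + v) * sbar) (\<sigma>s\<^sup>2 * (u\<^sup>2 + v\<^sup>2 + 2 * \<rho>s * u * v))" for u v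
      by (simp only: lincomb variance mean distrib_right)
  qed (use \<sigma>s \<rho>_le in auto)
  show "jointly_gaussian M (s k) (s (Suc k))
      \<and> correlation M (s k) (s (Suc k)) = \<rho>s
      \<and> \<P>(\<omega> in M. s (Suc k) \<omega> \<ge> \<Delta> \<bar> s k \<omega> < \<Delta>) = 1 - Phi2 a a \<rho>s / Phi a
      \<and> \<P>(\<omega> in M. s (Suc k) \<omega> < \<Delta> \<bar> s k \<omega> \<ge> \<Delta>) = (Phi a - Phi2 a a \<rho>s) / (1 - Phi a)"
    using jointly_gaussian correlation_eq switching_probabilities[of \<Delta>] unfolding a by blast
qed

end
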